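(* Let $(h_\alpha)$, $\alpha\in\mathbb{R}$, be a parametrized family of distortion functions with $h_{\alpha_0}(y)=y$, applied to the distribution function $F_X$ (distortion of the likelihood only; the prior $\Pi$ is not distorted). Assume that for $\Pi$-almost every $\theta$ the maps $\alpha\mapsto \log h'_\alpha(F_X(x_i|\theta))$, $i=1,\dots,n$, are differentiable at $\alpha=\alpha_0$. Let $\delta_0>0$, let $g:\Theta\to\mathbb{R}^s$ be measurable, and assume that for some $G(\cdot,\alpha_0)\in L^1(\Pi)$, $$\left|\delta^{-1} g(\theta)\big(\mathcal{L}_{h_{\alpha_0+\delta}}(\theta)-\mathcal{L}_{h_{\alpha_0}}(\theta)\big)\right|\le G(\theta,\alpha_0),\qquad |\delta|\le\delta_0,$$ holds for $\Pi$-almost every $\theta$. Then the Bayesian local sensitivity $\delta_n^{h_\alpha}=\frac{\partial}{\partial\alpha}\mathrm{E}_{\Pi^n_{h_\alpha}}[g(\vartheta)]\big|_{\alpha=\alpha_0}$ satisfies $$\delta_n^{h_\alpha}=\mathrm{Cov}_{\Pi^n}\Big[g(\vartheta),\ \sum_{i=1}^n\frac{\partial}{\partial\alpha}\log h'_\alpha(F_X(x_i|\vartheta))\Big|_{\alpha=\alpha_0}\Big].$$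
   Context: Setting: $\Theta\subseteq\mathbb{R}^k$ is the parameter space with prior probability distribution $\Pi$; $\vartheta$ is the random parameter with law $\Pi$. Given $\theta\in\Theta$, $X$ is an $\mathbb{R}^d$-valued random vector with distribution $P_\theta$, distribution function $F_X(\cdot|\theta)$ and density $f_X(\cdot|\theta)$. The sample $x_{1:n}=(x_1,\dots,x_n)$ is a fixed realisation of an i.i.d. sample $X_1,\dots,X_n$ of $X$. The likelihood is $\mathcal{L}(\theta)=\prod_{i=1}^n f_X(x_i|\theta)$, and $\Pi^n$ is the posterior, $d\Pi^n(\theta)=\mathcal{L}(\theta)d\Pi(\theta)/\int_\Theta\mathcal{L}\,d\Pi$ (Bayes' rule is assumed to be well defined). A distortion function is a differentiable, non-decreasing $h:[0,1]\to[0,1]$ with $h(0)=0$, $h(1)=1$; $h'$ denotes its derivative. The $h$-distorted likelihood is $\mathcal{L}_h(\theta)=\prod_{i=1}^n f_X(x_i|\theta)\,h'(F_X(x_i|\theta))$, and the distorted posterior (likelihood distortion only) is $\Pi^n_{h}(B)=\int_B\mathcal{L}_h\,d\Pi/\int_\Theta\mathcal{L}_h\,d\Pi$. In $h'_\alpha$, the prime is the derivative in the argument $y$ of $h_\alpha(y)$. $\mathrm{Cov}_{\Pi^n}[g(\vartheta),T(\vartheta)]$ for $g$ valued in $\mathbb{R}^s$ and $T$ real-valued is the vector in $\mathbb{R}^s$ of covariances of the components of $g(\vartheta)$ with $T(\vartheta)$, for $\vartheta\sim\Pi^n$.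
   Formalization: The formal theorem also assumes the domination condition with g replaced by 1 (own radius and integrable majorant), so the normalising constant can be differentiated under the integral; without it the claim fails where g vanishes. The posterior mean of g is assumed to exist. *)

theory Defs
  imports "HOL-Probability.Probability"
begin

text \<open>
  The componentwise order on \<^typ>\<open>real ^ 'd\<close> makes \<^term>\<open>{..z}\<close> the lower orthant
  at \<^term>\<open>z\<close>; the library's \<open>cdf\<close> is for \<^typ>\<open>real\<close> only.
\<close>

definition mcdf :: "(real ^ 'd) measure \<Rightarrow> real ^ 'd \<Rightarrow> real" where
  "mcdf M z = measure M {..z}"

text \<open>
  \<open>P \<theta>\<close> is the law of one observation given \<open>\<theta>\<close> and \<open>f \<theta>\<close> its Lebesgue density.
  Measurability in \<open>\<theta>\<close> is what Bayes' rule needs to make sense; \<open>\<Theta>\<close> itself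
  need not be a Borel set.
\<close>

locale bayes_model =
  fixes \<Theta> :: "(real ^ 'k) set"
    and prior :: "(real ^ 'k) measure"
    and P :: "real ^ 'k \<Rightarrow> (real ^ 'd) measure"
    and f :: "real ^ 'k \<Rightarrow> real ^ 'd \<Rightarrow> real"
  assumes prior_prob: "prob_space prior"
    and prior_sets: "sets prior = sets (restrict_space borel \<Theta>)"
    and kernel: "P \<in> prior \<rightarrow>\<^sub>M prob_algebra borel"
    and density_nonneg: "\<And>\<theta> z. \<theta> \<in> \<Theta> \<Longrightarrow> 0 \<le> f \<theta> z"
    and density_measurable: "\<And>\<theta>. \<theta> \<in> \<Theta> \<Longrightarrow> f \<theta> \<in> borel_measurable borel"
    and density: "\<And>\<theta>. \<theta> \<in> \<Theta> \<Longrightarrow> P \<theta> = density lborel (\<lambda>z. ennreal (f \<theta> z))"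
    and likelihood_measurable: "\<And>z. (\<lambda>\<theta>. f \<theta> z) \<in> borel_measurable prior"

definition distortion_function :: "(real \<Rightarrow> real) \<Rightarrow> bool" where
  "distortion_function h \<longleftrightarrow>
     h ` {0..1} \<subseteq> {0..1} \<and> h differentiable_on {0..1} \<and> mono_on {0..1} h \<and> h 0 = 0 \<and> h 1 = 1"

text \<open>
  Only the values of \<open>h\<close> on \<open>[0,1]\<close> matter, so the derivative is one-sided at 0 and 1.
\<close>

definition distortion_deriv :: "(real \<Rightarrow> real) \<Rightarrow> real \<Rightarrow> real" where
  "distortion_deriv h y = vector_derivative h (at y within {0..1})"

definition likelihood ::
    "('p \<Rightarrow> 'x \<Rightarrow> real) \<Rightarrow> nat \<Rightarrow> (nat \<Rightarrow> 'x) \<Rightarrow> 'p \<Rightarrow> real" where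
  "likelihood f n x \<theta> = (\<Prod>i = 1..n. f \<theta> (x i))"

definition distorted_likelihood ::
    "(real \<Rightarrow> real) \<Rightarrow> ('p \<Rightarrow> (real ^ 'd) measure) \<Rightarrow> ('p \<Rightarrow> real ^ 'd \<Rightarrow> real) \<Rightarrow>
     nat \<Rightarrow> (nat \<Rightarrow> real ^ 'd) \<Rightarrow> 'p \<Rightarrow> real" where
  "distorted_likelihood h P f n x \<theta> =
     (\<Prod>i = 1..n. f \<theta> (x i) * distortion_deriv h (mcdf (P \<theta>) (x i)))"

definition posterior :: "'p measure \<Rightarrow> ('p \<Rightarrow> real) \<Rightarrow> 'p measure" where
  "posterior prior L = density prior (\<lambda>\<theta>. ennreal (L \<theta> / (\<integral>\<theta>'. L \<theta>' \<partial>prior)))"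

definition distortion_score ::
    "(real \<Rightarrow> real \<Rightarrow> real) \<Rightarrow> real \<Rightarrow> ('p \<Rightarrow> (real ^ 'd) measure) \<Rightarrow>
     nat \<Rightarrow> (nat \<Rightarrow> real ^ 'd) \<Rightarrow> 'p \<Rightarrow> real" where
  "distortion_score h \<alpha>\<^sub>0 P n x \<theta> =
     (\<Sum>i = 1..n. deriv (\<lambda>\<alpha>. ln (distortion_deriv (h \<alpha>) (mcdf (P \<theta>) (x i)))) \<alpha>\<^sub>0)"

definition covariance :: "'p measure \<Rightarrow> ('p \<Rightarrow> real) \<Rightarrow> ('p \<Rightarrow> real) \<Rightarrow> real" where
  "covariance M U V =
     (\<integral>\<theta>. (U \<theta> - (\<integral>\<theta>'. U \<theta>' \<partial>M)) * (V \<theta> - (\<integral>\<theta>'. V \<theta>' \<partial>M)) \<partial>M)"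

definition covariance_vec ::
    "'p measure \<Rightarrow> ('p \<Rightarrow> real ^ 's) \<Rightarrow> ('p \<Rightarrow> real) \<Rightarrow> real ^ 's" where
  "covariance_vec M g T = (\<chi> j. covariance M (\<lambda>\<theta>. g \<theta> $ j) T)"

text \<open>
  Bochner integrals of non-integrable functions are 0, so existence of a covariance
  has to be said separately.
\<close>

definition covariance_exists ::
    "'p measure \<Rightarrow> ('p \<Rightarrow> real ^ 's) \<Rightarrow> ('p \<Rightarrow> real) \<Rightarrow> bool" where
  "covariance_exists M g T \<longleftrightarrow>
     integrable M g \<and> integrable M T \<and> integrable M (\<lambda>\<theta>. T \<theta> *\<^sub>R g \<theta>)"

text \<open>
  Difference quotients in \<open>\<alpha>\<close>, weighted by \<open>g\<close>, have a common integrable majorant for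
  \<open>0 < \<bar>\<delta>\<bar> \<le> \<delta>\<^sub>0\<close>.
\<close>

definition dominated_quotients ::
    "'p measure \<Rightarrow> (real \<Rightarrow> 'p \<Rightarrow> real) \<Rightarrow> real \<Rightarrow> real \<Rightarrow>
     ('p \<Rightarrow> 'b :: real_normed_vector) \<Rightarrow> ('p \<Rightarrow> real) \<Rightarrow> bool" where
  "dominated_quotients prior L \<alpha>\<^sub>0 \<delta>\<^sub>0 g G \<longleftrightarrow>
     integrable prior G \<and>
     (AE \<theta> in prior. \<forall>\<delta>. \<delta> \<noteq> 0 \<and> \<bar>\<delta>\<bar> \<le> \<delta>\<^sub>0 \<longrightarrow>
        norm (inverse \<delta> *\<^sub>R ((L (\<alpha>\<^sub>0 + \<delta>) \<theta> - L \<alpha>\<^sub>0 \<theta>) *\<^sub>R g \<theta>)) \<le> G \<theta>)"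

end

theory Submission
  imports Defs "HOL-Real_Asymp.Real_Asymp"
begin

text \<open>
  Since \<open>h\<^bsub>\<alpha>\<^sub>0\<^esub>\<close> has derivative 1, the likelihood is undistorted at \<open>\<alpha>\<^sub>0\<close>, and the logarithmic
  derivative of the product shows that the \<open>\<alpha>\<close>-derivative of the distorted likelihood is the
  likelihood times the score. Dominated convergence moves the derivative inside the numerator
  and the normalising constant of the posterior expectation, and the quotient rule then yields
  \<open>E[g T] - E[g] E[T]\<close> under the posterior.
\<close>

section \<open>Differentiation under the integral\<close>

text \<open>The remainder in the definition of the derivative is \<open>\<delta>\<close> times the
  quotient minus \<open>D\<close>. This gives the quotient form in which
  \<open>dominated_quotients\<close> states its bound.\<close>

lemma has_vector_derivative_iff_LIM:
  "(F has_vector_derivative D) (at a) \<longleftrightarrow>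
     ((\<lambda>\<delta>. inverse \<delta> *\<^sub>R (F (a + \<delta>) - F a)) \<longlongrightarrow> D) (at 0)"
proof -
  have "norm (F (a + \<delta>) - F a - \<delta> *\<^sub>R D) / norm \<delta> = norm (inverse \<delta> *\<^sub>R (F (a + \<delta>) - F a) - D)"
    if "\<delta> \<noteq> 0" for \<delta>
  proof -
    have "F (a + \<delta>) - F a - \<delta> *\<^sub>R D = \<delta> *\<^sub>R (inverse \<delta> *\<^sub>R (F (a + \<delta>) - F a) - D)"
      using that by (simp add: algebra_simps)
    then show ?thesis
      using that by simp
  qed
  then have "((\<lambda>\<delta>. norm (F (a + \<delta>) - F a - \<delta> *\<^sub>R D) / norm \<delta>) \<longlongrightarrow> 0) (at 0) \<longleftrightarrow>
      ((\<lambda>\<delta>. norm (inverse \<delta> *\<^sub>R (F (a + \<delta>) - F a) - D)) \<longlongrightarrow> 0) (at 0)"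
    by (intro filterlim_cong) (auto simp: eventually_at_filter)
  then show ?thesis
    unfolding has_vector_derivative_def has_derivative_at
    by (simp add: bounded_linear_scaleR_left tendsto_norm_zero_iff flip: LIM_zero_iff[of _ D])
qed

text \<open>Dominated convergence applied to the difference quotients themselves. Because
  \<open>G\<close> bounds the quotients directly, no mean value argument is needed and
  differentiability at the single point \<open>a\<close> suffices.\<close>

lemma has_vector_derivative_integral_dominated:
  fixes F :: "real \<Rightarrow> 'a \<Rightarrow> 'b :: {banach, second_countable_topology}"
  assumes meas: "\<And>\<alpha>. F \<alpha> \<in> borel_measurable M" "D \<in> borel_measurable M"
    and int: "integrable M (F a)" "integrable M G"
    and deriv: "AE \<theta> in M. ((\<lambda>\<alpha>. F \<alpha> \<theta>) has_vector_derivative D \<theta>) (at a)"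
    and bound: "0 < r"
      "AE \<theta> in M. \<forall>\<delta>. \<delta> \<noteq> 0 \<and> \<bar>\<delta>\<bar> \<le> r \<longrightarrow> norm (inverse \<delta> *\<^sub>R (F (a + \<delta>) \<theta> - F a \<theta>)) \<le> G \<theta>"
  shows "integrable M D"
    and "((\<lambda>\<alpha>. \<integral>\<theta>. F \<alpha> \<theta> \<partial>M) has_vector_derivative (\<integral>\<theta>. D \<theta> \<partial>M)) (at a)"
proof -
  let ?q = "\<lambda>\<delta> \<theta>. inverse \<delta> *\<^sub>R (F (a + \<delta>) \<theta> - F a \<theta>)"
  note [measurable] = meas
  have quot_integrable: "integrable M (?q \<delta>)" if "\<delta> \<noteq> 0" "\<bar>\<delta>\<bar> \<le> r" for \<delta>
  proof (rule Bochner_Integration.integrable_bound[OF int(2)])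
    show "AE \<theta> in M. norm (?q \<delta> \<theta>) \<le> norm (G \<theta>)"
      using bound(2)
    proof eventually_elim
      case (elim \<theta>)
      then have "norm (?q \<delta> \<theta>) \<le> G \<theta>"
        using that by blast
      then show ?case
        by simp
    qed
  qed measurable
  have quot_integral: "(\<integral>\<theta>. ?q \<delta> \<theta> \<partial>M) = inverse \<delta> *\<^sub>R ((\<integral>\<theta>. F (a + \<delta>) \<theta> \<partial>M) - (\<integral>\<theta>. F a \<theta> \<partial>M))"
    if "\<delta> \<noteq> 0" "\<bar>\<delta>\<bar> \<le> r" for \<delta>
  proof -
    \<comment> \<open>Integrability is given at \<open>a\<close> only. Rebuilding
      \<open>F (a + \<delta>)\<close> from its quotient makes it integrable for small
      \<open>\<delta>\<close>, so the integral of the difference splits.\<close>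
    have "integrable M (\<lambda>\<theta>. \<delta> *\<^sub>R ?q \<delta> \<theta> + F a \<theta>)"
      by (rule Bochner_Integration.integrable_add[OF integrable_scaleR_right[OF quot_integrable[OF that]] int(1)])
    then have "integrable M (F (a + \<delta>))"
      using that by simp
    then show ?thesis
      using int(1) by simp
  qed
  \<comment> \<open>Dominated convergence is a statement about sequences, so the limit at 0 is
    tested along sequences of nonzero increments.\<close>
  have quot_tendsto: "integrable M D \<and> (\<lambda>k. \<integral>\<theta>. ?q (X k) \<theta> \<partial>M) \<longlonglongrightarrow> (\<integral>\<theta>. D \<theta> \<partial>M)"
    if X: "\<And>k. X k \<noteq> 0" "\<And>k. \<bar>X k\<bar> \<le> r" "X \<longlonglongrightarrow> 0" for X :: "nat \<Rightarrow> real"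
  proof -
    have lim: "AE \<theta> in M. (\<lambda>k. ?q (X k) \<theta>) \<longlonglongrightarrow> D \<theta>"
      using deriv
    proof eventually_elim
      case (elim \<theta>)
      then show ?case
        using X unfolding has_vector_derivative_iff_LIM tendsto_at_iff_sequentially
        by (auto simp: comp_def)
    qed
    have dom: "AE \<theta> in M. norm (?q (X k) \<theta>) \<le> G \<theta>" for k
      using bound(2) by eventually_elim (use X in blast)
    show ?thesis
      using integrable_dominated_convergence[OF _ _ int(2) lim dom]
        integral_dominated_convergence[OF _ _ int(2) lim dom] by simp
  qed
  show "integrable M D"
    \<comment> \<open>Any admissible sequence yields integrability of the limit; this one is nonzero
      and stays within \<open>r\<close>.\<close>
    using quot_tendsto[of "\<lambda>k. r / real (Suc k)"] bound(1) LIMSEQ_Suc[OF lim_const_over_n[of r]]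
    by (auto simp: field_simps)
  show "((\<lambda>\<alpha>. \<integral>\<theta>. F \<alpha> \<theta> \<partial>M) has_vector_derivative (\<integral>\<theta>. D \<theta> \<partial>M)) (at a)"
    unfolding has_vector_derivative_iff_LIM tendsto_at_iff_sequentially
  proof (intro allI impI)
    fix X :: "nat \<Rightarrow> real"
    assume X: "\<forall>k. X k \<in> UNIV - {0}" "X \<longlonglongrightarrow> 0"
    \<comment> \<open>An arbitrary null sequence may start with increments beyond \<open>r\<close>,
      where no bound is available; the first \<open>N\<close> terms are dropped.\<close>
    have "eventually (\<lambda>k. \<bar>X k\<bar> < r) sequentially"
      using X(2) bound(1) by (auto dest: tendstoD)
    then obtain N where N: "\<And>k. k \<ge> N \<Longrightarrow> \<bar>X k\<bar> < r"
      by (auto simp: eventually_sequentially)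
    have "(\<lambda>k. \<integral>\<theta>. ?q (X (k + N)) \<theta> \<partial>M) \<longlonglongrightarrow> (\<integral>\<theta>. D \<theta> \<partial>M)"
      using X N by (intro quot_tendsto[THEN conjunct2] LIMSEQ_ignore_initial_segment) (auto intro: less_imp_le)
    then have "(\<lambda>k. inverse (X (k + N)) *\<^sub>R ((\<integral>\<theta>. F (a + X (k + N)) \<theta> \<partial>M) - (\<integral>\<theta>. F a \<theta> \<partial>M)))
        \<longlonglongrightarrow> (\<integral>\<theta>. D \<theta> \<partial>M)"
      using X N by (subst (asm) quot_integral) (auto intro: less_imp_le)
    then show "((\<lambda>\<delta>. inverse \<delta> *\<^sub>R ((\<integral>\<theta>. F (a + \<delta>) \<theta> \<partial>M) - (\<integral>\<theta>. F a \<theta> \<partial>M))) \<circ> X)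
        \<longlonglongrightarrow> (\<integral>\<theta>. D \<theta> \<partial>M)"
      unfolding comp_def by (rule LIMSEQ_offset)
  qed
qed

section \<open>Sensitivity of posterior expectations\<close>

text \<open>Preimages under \<open>T\<close> and \<open>S\<close> differ by a subset of a null set,
  and the completion contains such sets. This makes the score measurable.\<close>

lemma borel_measurable_completion_AE:
  fixes T :: "'a \<Rightarrow> 'b :: topological_space"
  assumes S[measurable]: "S \<in> borel_measurable M" and eq: "AE \<theta> in M. T \<theta> = S \<theta>"
  shows "T \<in> borel_measurable (completion M)"
proof (rule measurableI)
  fix A :: "'b set" assume A: "A \<in> sets borel"
  show "T -` A \<inter> space (completion M) \<in> sets (completion M)"
  proof (rule completion.in_sets_AE)
    show "AE \<theta> in completion M. (\<theta> \<in> S -` A \<inter> space M) = (\<theta> \<in> T -` A \<inter> space (completion M))"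
      using AE_completion[OF eq] by eventually_elim simp
    show "S -` A \<inter> space M \<in> sets (completion M)"
      using A by (auto intro: measurable_sets[OF S])
  qed auto
qed simp

section \<open>Covariance: product formula, null-set changes and completion\<close>

lemma covariance_eq:
  assumes "prob_space M" "integrable M U" "integrable M V" "integrable M (\<lambda>\<theta>. U \<theta> * V \<theta>)"
  shows "covariance M U V = (\<integral>\<theta>. U \<theta> * V \<theta> \<partial>M) - (\<integral>\<theta>. U \<theta> \<partial>M) * (\<integral>\<theta>. V \<theta> \<partial>M)"
proof -
  interpret prob_space M by fact
  define u v where "u = (\<integral>\<theta>. U \<theta> \<partial>M)" and "v = (\<integral>\<theta>. V \<theta> \<partial>M)"
  have "covariance M U V = (\<integral>\<theta>. U \<theta> * V \<theta> - v * U \<theta> - u * V \<theta> + u * v \<partial>M)"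
    unfolding covariance_def u_def[symmetric] v_def[symmetric]
    by (intro Bochner_Integration.integral_cong) (auto simp: algebra_simps)
  also have "\<dots> = (\<integral>\<theta>. U \<theta> * V \<theta> \<partial>M) - u * v"
    using assms(2-) by (simp add: prob_space flip: u_def v_def)
  finally show ?thesis
    by (simp add: u_def v_def)
qed

lemma covariance_cong_AE:
  assumes "AE \<theta> in M. V \<theta> = W \<theta>" "U \<in> borel_measurable M" "V \<in> borel_measurable M" "W \<in> borel_measurable M"
  shows "covariance M U V = covariance M U W"
proof -
  have "(\<integral>\<theta>. V \<theta> \<partial>M) = (\<integral>\<theta>. W \<theta> \<partial>M)"
    using assms by (intro integral_cong_AE) auto
  then show ?thesis
    unfolding covariance_def using assms by (intro integral_cong_AE) auto
qed

lemma covariance_completion: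
  assumes "U \<in> borel_measurable M" "V \<in> borel_measurable M"
  shows "covariance (completion M) U V = covariance M U V"
  using assms by (simp add: covariance_def integral_completion)

section \<open>Posterior integrals as weighted prior integrals\<close>

lemma integrable_scaleR_right_iff:
  fixes f :: "'a \<Rightarrow> 'b :: {banach, second_countable_topology}"
  assumes "c \<noteq> 0"
  shows "integrable M (\<lambda>\<theta>. c *\<^sub>R f \<theta>) \<longleftrightarrow> integrable M f"
proof
  assume "integrable M (\<lambda>\<theta>. c *\<^sub>R f \<theta>)"
  then have "integrable M (\<lambda>\<theta>. inverse c *\<^sub>R (c *\<^sub>R f \<theta>))"
    by (rule integrable_scaleR_right)
  then show "integrable M f"
    using assms by simp
qed (rule integrable_scaleR_right)

text \<open>The two sides differ by the constant factor \<open>1/Z\<close>, where \<open>Z\<close>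
  is the normaliser. Positivity matters: for \<open>Z = 0\<close> the division convention makes the
  posterior the zero measure, under which every measurable function is integrable.\<close>

lemma integrable_posterior_iff:
  fixes g :: "'a \<Rightarrow> 'b :: {banach, second_countable_topology}"
  assumes "L \<in> borel_measurable M" "g \<in> borel_measurable M"
    and nonneg: "\<And>\<theta>. \<theta> \<in> space M \<Longrightarrow> 0 \<le> L \<theta>" and pos: "0 < (\<integral>\<theta>. L \<theta> \<partial>M)"
  shows "integrable (posterior M L) g \<longleftrightarrow> integrable M (\<lambda>\<theta>. L \<theta> *\<^sub>R g \<theta>)"
proof -
  have "integrable (posterior M L) g \<longleftrightarrow> integrable M (\<lambda>\<theta>. inverse (\<integral>\<theta>. L \<theta> \<partial>M) *\<^sub>R (L \<theta> *\<^sub>R g \<theta>))"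
    unfolding posterior_def using assms
    by (subst integrable_density) (auto simp: divide_inverse mult.commute)
  then show ?thesis
    using pos by (simp add: integrable_scaleR_right_iff del: scaleR_scaleR)
qed

text \<open>No condition on the normaliser is imposed: if it is 0, or 0 by the default for
  non-integrable \<open>L\<close>, both sides vanish. The formula therefore holds at every parameter
  value, not only near the base point.\<close>

lemma integral_posterior:
  fixes g :: "'a \<Rightarrow> 'b :: {banach, second_countable_topology}"
  assumes "L \<in> borel_measurable M" "g \<in> borel_measurable M"
    and nonneg: "\<And>\<theta>. \<theta> \<in> space M \<Longrightarrow> 0 \<le> L \<theta>"
  shows "(\<integral>\<theta>. g \<theta> \<partial>(posterior M L)) = inverse (\<integral>\<theta>. L \<theta> \<partial>M) *\<^sub>R (\<integral>\<theta>. L \<theta> *\<^sub>R g \<theta> \<partial>M)"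
proof -
  have "(\<integral>\<theta>. g \<theta> \<partial>(posterior M L)) = (\<integral>\<theta>. inverse (\<integral>\<theta>. L \<theta> \<partial>M) *\<^sub>R (L \<theta> *\<^sub>R g \<theta>) \<partial>M)"
    unfolding posterior_def using assms
    by (subst integral_density) (auto simp: divide_inverse mult.commute intro!: AE_I2 mult_nonneg_nonneg)
  then show ?thesis
    by (simp del: scaleR_scaleR)
qed

lemma prob_space_posterior:
  assumes [measurable]: "L \<in> borel_measurable M"
    and nonneg: "\<And>\<theta>. \<theta> \<in> space M \<Longrightarrow> 0 \<le> L \<theta>"
    and int: "integrable M L" and pos: "0 < (\<integral>\<theta>. L \<theta> \<partial>M)"
  shows "prob_space (posterior M L)"
proof
  have "emeasure (posterior M L) (space (posterior M L)) = (\<integral>\<^sup>+\<theta>. ennreal (L \<theta> / (\<integral>\<theta>. L \<theta> \<partial>M)) \<partial>M)"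
    unfolding posterior_def by (simp add: emeasure_density cong: nn_integral_cong)
  also have "\<dots> = ennreal (\<integral>\<theta>. L \<theta> / (\<integral>\<theta>. L \<theta> \<partial>M) \<partial>M)"
    using nonneg int pos by (intro nn_integral_eq_integral) auto
  finally show "emeasure (posterior M L) (space (posterior M L)) = 1"
    using pos by simp
qed

text \<open>Numerator and normaliser are differentiated separately, which is why there are two radii
  and two majorants: weight \<open>g\<close> for the former, weight 1 for the latter.\<close>

lemma has_vector_derivative_posterior_expectation:
  fixes L :: "real \<Rightarrow> 'a \<Rightarrow> real" and g :: "'a \<Rightarrow> real ^ 's"
  assumes L_meas: "\<And>\<alpha>. L \<alpha> \<in> borel_measurable M"
    and L_nonneg: "\<And>\<alpha> \<theta>. \<theta> \<in> space M \<Longrightarrow> 0 \<le> L \<alpha> \<theta>"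
    and L_int: "integrable M (L a)" and L_pos: "0 < (\<integral>\<theta>. L a \<theta> \<partial>M)"
    and g_meas: "g \<in> borel_measurable M" and g_int: "integrable (posterior M (L a)) g"
    and deriv: "AE \<theta> in M. ((\<lambda>\<alpha>. L \<alpha> \<theta>) has_real_derivative L a \<theta> * T \<theta>) (at a)"
    and dom_g: "0 < r" "dominated_quotients M L a r g G"
    and dom_1: "0 < r\<^sub>1" "dominated_quotients M L a r\<^sub>1 (\<lambda>_. 1 :: real) G\<^sub>1"
  shows "covariance_exists (completion (posterior M (L a))) g T"
    and "((\<lambda>\<alpha>. \<integral>\<theta>. g \<theta> \<partial>(posterior M (L \<alpha>))) has_vector_derivative
           covariance_vec (completion (posterior M (L a))) g T) (at a)"
proof -
  note [measurable] = L_meas g_meas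
  let ?post = "posterior M (L a)"
  have sets_post[measurable_cong]: "sets ?post = sets M"
    by (simp add: posterior_def)
  interpret post: prob_space ?post
    using assms by (intro prob_space_posterior) auto

  \<comment> \<open>\<open>T\<close> need not be measurable; on \<open>L a > 0\<close> it agrees almost everywhere with the measurable \<open>S\<close>.\<close>
  define D where "D \<theta> = lim (\<lambda>k. inverse (1 / real (Suc k)) *\<^sub>R (L (a + 1 / real (Suc k)) \<theta> - L a \<theta>))" for \<theta>
  define S where "S \<theta> = D \<theta> / L a \<theta>" for \<theta>
  have [measurable]: "D \<in> borel_measurable M"
    unfolding D_def by measurable
  have [measurable]: "S \<in> borel_measurable M"
    unfolding S_def by measurable
  have D_eq: "AE \<theta> in M. D \<theta> = L a \<theta> * T \<theta>"
    using deriv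
  proof eventually_elim
    case (elim \<theta>)
    then have "((\<lambda>\<delta>. inverse \<delta> *\<^sub>R (L (a + \<delta>) \<theta> - L a \<theta>)) \<longlongrightarrow> L a \<theta> * T \<theta>) (at 0)"
      by (simp add: has_real_derivative_iff_has_vector_derivative has_vector_derivative_iff_LIM)
    moreover have "filterlim (\<lambda>k. 1 / real (Suc k)) (at 0) sequentially"
      by real_asymp
    ultimately have "(\<lambda>k. inverse (1 / real (Suc k)) *\<^sub>R (L (a + 1 / real (Suc k)) \<theta> - L a \<theta>)) \<longlonglongrightarrow> L a \<theta> * T \<theta>"
      by (rule filterlim_compose)
    then show ?case
      unfolding D_def by (rule limI)
  qed
  \<comment> \<open>Where \<open>L a \<theta> = 0\<close>, \<open>S \<theta>\<close> is 0 by the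
    division convention, but there \<open>D \<theta>\<close> is 0 as well by
    \<open>D_eq\<close>.\<close>
  have D_eq_S: "AE \<theta> in M. D \<theta> = L a \<theta> * S \<theta>"
    using D_eq by eventually_elim (auto simp: S_def)
  have deriv_S: "AE \<theta> in M. ((\<lambda>\<alpha>. L \<alpha> \<theta>) has_vector_derivative L a \<theta> * S \<theta>) (at a)"
    using deriv D_eq D_eq_S
    by eventually_elim (metis has_real_derivative_iff_has_vector_derivative)
  \<comment> \<open>The posterior does not charge the zeros of \<open>L a\<close>, so
    \<open>L a\<close> can be cancelled from \<open>D_eq\<close> there.\<close>
  have "AE \<theta> in ?post. 0 < L a \<theta>"
    unfolding posterior_def using L_nonneg L_pos
    by (subst AE_density) (auto simp: zero_less_divide_iff intro!: AE_I2)
  moreover have "AE \<theta> in ?post. D \<theta> = L a \<theta> * T \<theta>"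
    unfolding posterior_def using D_eq by (subst AE_density) auto
  ultimately have T_eq: "AE \<theta> in ?post. T \<theta> = S \<theta>"
    by eventually_elim (simp add: S_def)
  then have T_eq': "AE \<theta> in completion ?post. T \<theta> = S \<theta>"
    by (rule AE_completion)
  have T_meas[measurable]: "T \<in> borel_measurable (completion ?post)"
    using T_eq by (rule borel_measurable_completion_AE[rotated]) measurable
  have [measurable]: "S \<in> borel_measurable (completion ?post)" "g \<in> borel_measurable (completion ?post)"
    by (auto intro!: measurable_completion)

  note iff = integrable_posterior_iff[OF L_meas _ L_nonneg L_pos]
  have Lg_int: "integrable M (\<lambda>\<theta>. L a \<theta> *\<^sub>R g \<theta>)"
    using g_int by (simp add: iff)
  \<comment> \<open>The derivative is written with \<open>S\<close> instead of \<open>T\<close>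
    because the dominated differentiation lemma needs an \<open>M\<close>-measurable
    integrand.\<close>
  have LS: "integrable M (\<lambda>\<theta>. L a \<theta> * S \<theta>)"
    and Z': "((\<lambda>\<alpha>. \<integral>\<theta>. L \<alpha> \<theta> \<partial>M) has_vector_derivative (\<integral>\<theta>. L a \<theta> * S \<theta> \<partial>M)) (at a)"
    using has_vector_derivative_integral_dominated[of L M "\<lambda>\<theta>. L a \<theta> * S \<theta>" a G\<^sub>1 r\<^sub>1] dom_1 L_int deriv_S
    by (auto simp: dominated_quotients_def)
  have LSg: "integrable M (\<lambda>\<theta>. (L a \<theta> * S \<theta>) *\<^sub>R g \<theta>)"
    and N': "((\<lambda>\<alpha>. \<integral>\<theta>. L \<alpha> \<theta> *\<^sub>R g \<theta> \<partial>M) has_vector_derivative (\<integral>\<theta>. (L a \<theta> * S \<theta>) *\<^sub>R g \<theta> \<partial>M)) (at a)"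
  proof -
    have "AE \<theta> in M. ((\<lambda>\<alpha>. L \<alpha> \<theta> *\<^sub>R g \<theta>) has_vector_derivative (L a \<theta> * S \<theta>) *\<^sub>R g \<theta>) (at a)"
      using deriv_S by eventually_elim (rule bounded_linear.has_vector_derivative[OF bounded_linear_scaleR_left])
    then show "integrable M (\<lambda>\<theta>. (L a \<theta> * S \<theta>) *\<^sub>R g \<theta>)"
      "((\<lambda>\<alpha>. \<integral>\<theta>. L \<alpha> \<theta> *\<^sub>R g \<theta> \<partial>M) has_vector_derivative (\<integral>\<theta>. (L a \<theta> * S \<theta>) *\<^sub>R g \<theta> \<partial>M)) (at a)"
      using has_vector_derivative_integral_dominated[of "\<lambda>\<alpha> \<theta>. L \<alpha> \<theta> *\<^sub>R g \<theta>" M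
          "\<lambda>\<theta>. (L a \<theta> * S \<theta>) *\<^sub>R g \<theta>" a G r] dom_g Lg_int
      by (auto simp: dominated_quotients_def simp flip: scaleR_diff_left)
  qed
  have S_int: "integrable ?post S" and Sg_int: "integrable ?post (\<lambda>\<theta>. S \<theta> *\<^sub>R g \<theta>)"
    using LS LSg by (simp_all add: iff)

  show "covariance_exists (completion ?post) g T"
    unfolding covariance_exists_def
  proof (intro conjI)
    show "integrable (completion ?post) g"
      using g_int by (subst integrable_completion) auto
    have "integrable (completion ?post) S"
      using S_int by (subst integrable_completion) auto
    then show "integrable (completion ?post) T"
      by (rule integrable_cong_AE_imp) (use T_eq' in auto)
    have "integrable (completion ?post) (\<lambda>\<theta>. S \<theta> *\<^sub>R g \<theta>)"
      using Sg_int by (subst integrable_completion) auto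
    then show "integrable (completion ?post) (\<lambda>\<theta>. T \<theta> *\<^sub>R g \<theta>)"
      by (rule integrable_cong_AE_imp) (use T_eq' in auto)
  qed

  let ?Z = "\<integral>\<theta>. L a \<theta> \<partial>M" and ?Z' = "\<integral>\<theta>. L a \<theta> * S \<theta> \<partial>M"
  let ?N = "\<integral>\<theta>. L a \<theta> *\<^sub>R g \<theta> \<partial>M" and ?N' = "\<integral>\<theta>. (L a \<theta> * S \<theta>) *\<^sub>R g \<theta> \<partial>M"
  \<comment> \<open>The numerator is a vector, so the quotient rule takes the form of a product rule
    for the real factor \<open>1/Z\<close> and the vector \<open>N\<close>.\<close>
  have inv: "((\<lambda>\<alpha>. inverse (\<integral>\<theta>. L \<alpha> \<theta> \<partial>M)) has_real_derivative - (inverse ?Z * ?Z' * inverse ?Z)) (at a)"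
    using Z' L_pos by (intro DERIV_inverse') (auto simp: has_real_derivative_iff_has_vector_derivative)
  have quotient: "((\<lambda>\<alpha>. inverse (\<integral>\<theta>. L \<alpha> \<theta> \<partial>M) *\<^sub>R (\<integral>\<theta>. L \<alpha> \<theta> *\<^sub>R g \<theta> \<partial>M)) has_vector_derivative
      inverse ?Z *\<^sub>R ?N' + (- (inverse ?Z * ?Z' * inverse ?Z)) *\<^sub>R ?N) (at a)"
    by (rule has_vector_derivative_scaleR[OF inv N'])
  have g_mean: "(\<integral>\<theta>. g \<theta> \<partial>?post) = inverse ?Z *\<^sub>R ?N"
    and S_mean: "(\<integral>\<theta>. S \<theta> \<partial>?post) = inverse ?Z * ?Z'"
    and Sg_mean: "(\<integral>\<theta>. S \<theta> *\<^sub>R g \<theta> \<partial>?post) = inverse ?Z *\<^sub>R ?N'"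
    using L_nonneg by (simp_all add: integral_posterior)
  have "covariance_vec (completion ?post) g T =
      (\<integral>\<theta>. S \<theta> *\<^sub>R g \<theta> \<partial>?post) - (\<integral>\<theta>. S \<theta> \<partial>?post) *\<^sub>R (\<integral>\<theta>. g \<theta> \<partial>?post)"
  proof (rule vec_eq_iff[THEN iffD2], rule allI)
    fix j
    have comp: "(\<integral>\<theta>. u \<theta> $ j \<partial>?post) = (\<integral>\<theta>. u \<theta> \<partial>?post) $ j" if "integrable ?post u" for u :: "'a \<Rightarrow> real ^ 's"
      using integral_bounded_linear[OF bounded_linear_vec_nth that] .
    have comp_int: "integrable ?post (\<lambda>\<theta>. u \<theta> $ j)" if "integrable ?post u" for u :: "'a \<Rightarrow> real ^ 's"
      using integrable_bounded_linear[OF bounded_linear_vec_nth that] .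
    have [measurable]: "(\<lambda>\<theta>. g \<theta> $ j) \<in> borel_measurable M"
      using measurable_compose[OF g_meas borel_measurable_nth] .
    then have [measurable]: "(\<lambda>\<theta>. g \<theta> $ j) \<in> borel_measurable (completion ?post)"
      by (intro measurable_completion) simp
    \<comment> \<open>The order matters: \<open>T\<close> is known to be measurable only for the
      completion, so it is replaced by \<open>S\<close> before the completion is removed.\<close>
    have "covariance_vec (completion ?post) g T $ j = covariance (completion ?post) (\<lambda>\<theta>. g \<theta> $ j) S"
      unfolding covariance_vec_def using T_eq' by (simp, intro covariance_cong_AE) auto
    also have "\<dots> = covariance ?post (\<lambda>\<theta>. g \<theta> $ j) S"
      by (intro covariance_completion) auto
    also have "\<dots> = (\<integral>\<theta>. (S \<theta> *\<^sub>R g \<theta>) $ j \<partial>?post) - (\<integral>\<theta>. g \<theta> $ j \<partial>?post) * (\<integral>\<theta>. S \<theta> \<partial>?post)"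
      using comp_int[OF Sg_int] comp_int[OF g_int] S_int
      by (subst covariance_eq) (auto simp: post.prob_space_axioms mult.commute)
    also have "\<dots> = ((\<integral>\<theta>. S \<theta> *\<^sub>R g \<theta> \<partial>?post) - (\<integral>\<theta>. S \<theta> \<partial>?post) *\<^sub>R (\<integral>\<theta>. g \<theta> \<partial>?post)) $ j"
      unfolding comp[OF Sg_int] comp[OF g_int] by simp
    finally show "covariance_vec (completion ?post) g T $ j = \<dots>" .
  qed
  also have "\<dots> = inverse ?Z *\<^sub>R ?N' + (- (inverse ?Z * ?Z' * inverse ?Z)) *\<^sub>R ?N"
    by (simp add: g_mean S_mean Sg_mean)
  finally show "((\<lambda>\<alpha>. \<integral>\<theta>. g \<theta> \<partial>(posterior M (L \<alpha>))) has_vector_derivative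
      covariance_vec (completion ?post) g T) (at a)"
    using quotient L_nonneg by (simp add: integral_posterior)
qed

section \<open>Distorted likelihoods\<close>

text \<open>Stepping towards the further endpoint keeps all difference quotients inside \<open>[0,1]\<close>.\<close>

lemma distortion_deriv_LIMSEQ:
  fixes s :: "real \<Rightarrow> nat \<Rightarrow> real"
  defines "s \<equiv> \<lambda>y k. (if y \<le> 1 / 2 then 1 else - 1) / (real k + 2)"
  assumes "distortion_function h" and y: "y \<in> {0..1}"
  shows "(\<lambda>k. (h (y + s y k) - h y) / s y k) \<longlonglongrightarrow> distortion_deriv h y"
    and "\<And>k. y + s y k \<in> {0..1}"
    and "\<And>k. 0 \<le> (h (y + s y k) - h y) / s y k"
proof -
  \<comment> \<open>The summand 2 keeps every step at most 1/2, and the further endpoint is at least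
    that far from \<open>y\<close>.\<close>
  have frac: "0 < 1 / (real k + 2)" "1 / (real k + 2) \<le> 1 / 2" for k
    by (simp_all add: field_simps)
  show mem: "y + s y k \<in> {0..1}" for k
  proof -
    define c where "c = 1 / (real k + 2)"
    have "s y k = (if y \<le> 1 / 2 then c else - c)"
      by (simp add: s_def c_def)
    moreover have "0 < c" "c \<le> 1 / 2"
      using frac[of k] by (simp_all only: c_def)
    ultimately show ?thesis
      using y by auto
  qed
  have "(h has_vector_derivative distortion_deriv h y) (at y within {0..1})"
    using assms unfolding distortion_deriv_def distortion_function_def
    by (auto simp: differentiable_on_def vector_derivative_works)
  then have lim: "((\<lambda>z. (h z - h y) / (z - y)) \<longlongrightarrow> distortion_deriv h y) (at y within {0..1})"
    by (simp add: has_field_derivative_iff flip: has_real_derivative_iff_has_vector_derivative)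
  have "(\<lambda>k. y + s y k) \<longlonglongrightarrow> y + 0"
    unfolding s_def by (intro tendsto_add tendsto_const) real_asymp
  moreover have "s y k \<noteq> 0" for k
    by (simp add: s_def add_nonneg_eq_0_iff)
  ultimately have "filterlim (\<lambda>k. y + s y k) (at y within {0..1}) sequentially"
    using mem by (simp add: filterlim_at del: atLeastAtMost_iff)
  from filterlim_compose[OF lim this] show "(\<lambda>k. (h (y + s y k) - h y) / s y k) \<longlonglongrightarrow> distortion_deriv h y"
    by simp
  have "mono_on {0..1} h"
    using assms by (simp add: distortion_function_def)
  then have mono: "h u \<le> h v" if "u \<in> {0..1}" "v \<in> {0..1}" "u \<le> v" for u v
    using that by (rule monotone_onD)
  show "0 \<le> (h (y + s y k) - h y) / s y k" for k
  proof (cases "0 \<le> s y k")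
    case True
    then show ?thesis
      using mono[OF y mem[of k]] by simp
  next
    case False
    then show ?thesis
      using mono[OF mem[of k] y] by (intro divide_nonpos_neg) auto
  qed
qed

lemma distortion_deriv_nonneg:
  assumes "distortion_function h" "y \<in> {0..1}"
  shows "0 \<le> distortion_deriv h y"
  by (rule LIMSEQ_le_const[OF distortion_deriv_LIMSEQ(1)[OF assms]]) (use distortion_deriv_LIMSEQ(3)[OF assms] in auto)

text \<open>The derivative need not be continuous, but it is a pointwise limit of difference
  quotients. These are Borel because \<open>h\<close> is monotone and the step depends on
  \<open>y\<close> only through the threshold 1/2.\<close>

lemma distortion_deriv_measurable:
  assumes h: "distortion_function h"
  shows "distortion_deriv h \<in> borel_measurable (restrict_space borel {0..1})"
proof (rule borel_measurable_LIMSEQ_real)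
  let ?I = "restrict_space borel {0..1 :: real}"
  let ?s = "\<lambda>y k. (if y \<le> 1 / 2 then 1 else - 1 :: real) / (real k + 2)"
  show "(\<lambda>k. (h (y + ?s y k) - h y) / ?s y k) \<longlonglongrightarrow> distortion_deriv h y" if "y \<in> space ?I" for y
    using distortion_deriv_LIMSEQ(1)[OF h, of y] that by (simp add: space_restrict_space)
  have [measurable]: "h \<in> borel_measurable ?I"
    using h by (intro borel_measurable_mono_on_fnc) (simp add: distortion_function_def)
  have [measurable]: "(\<lambda>y. y) \<in> borel_measurable ?I"
    by (intro measurable_restrict_space1) simp
  have [measurable]: "(\<lambda>y. y + ?s y k) \<in> ?I \<rightarrow>\<^sub>M ?I" for k
    using distortion_deriv_LIMSEQ(2)[OF h]
    by (intro measurable_restrict_space2) (auto simp: space_restrict_space)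
  have [measurable]: "(\<lambda>y. h (y + ?s y k)) \<in> borel_measurable ?I" for k
    by (rule measurable_compose[of "\<lambda>y. y + ?s y k" ?I ?I h]) measurable
  show "(\<lambda>y. (h (y + ?s y k) - h y) / ?s y k) \<in> borel_measurable ?I" for k
    by measurable
qed

text \<open>Agreement with the identity on \<open>{0..1}\<close> suffices even at the endpoints,
  since derivatives within a nondegenerate interval are unique.\<close>

lemma distortion_deriv_id:
  assumes "\<And>y. y \<in> {0..1} \<Longrightarrow> h y = y" "y \<in> {0..1}"
  shows "distortion_deriv h y = 1"
  unfolding distortion_deriv_def
proof (rule vector_derivative_within_closed_interval)
  have "((\<lambda>y. y) has_vector_derivative 1) (at y within {0..1})"
    by (auto intro!: derivative_eq_intros)
  then show "(h has_vector_derivative 1) (at y within {0..1})"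
    by (rule has_vector_derivative_transform[rotated 2]) (use assms in auto)
qed (use assms in auto)

text \<open>Logarithmic differentiation. Positivity in a neighbourhood gives
  \<open>exp (ln w) = w\<close> there, which carries differentiability from the logarithm to the
  weight \<open>w\<close> itself.\<close>

lemma has_real_derivative_distorted_likelihood:
  assumes pos: "\<And>i. i \<in> {1..n} \<Longrightarrow>
        \<forall>\<^sub>F \<alpha> in nhds a. 0 < distortion_deriv (h \<alpha>) (mcdf (P \<theta>) (x i))"
    and diff: "\<And>i. i \<in> {1..n} \<Longrightarrow>
        (\<lambda>\<alpha>. ln (distortion_deriv (h \<alpha>) (mcdf (P \<theta>) (x i)))) differentiable (at a)"
  shows "((\<lambda>\<alpha>. distorted_likelihood (h \<alpha>) P f n x \<theta>) has_real_derivative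
      distorted_likelihood (h a) P f n x \<theta> * distortion_score h a P n x \<theta>) (at a)"
proof -
  let ?w = "\<lambda>i \<alpha>. distortion_deriv (h \<alpha>) (mcdf (P \<theta>) (x i))"
  let ?l = "\<lambda>i. deriv (\<lambda>\<alpha>. ln (?w i \<alpha>)) a"
  have pos_a: "0 < ?w i a" if "i \<in> {1..n}" for i
    using eventually_nhds_x_imp_x[OF pos[OF that]] .
  have w: "(?w i has_real_derivative ?w i a * ?l i) (at a)" if i: "i \<in> {1..n}" for i
  proof -
    have "((\<lambda>\<alpha>. ln (?w i \<alpha>)) has_real_derivative ?l i) (at a)"
      using diff[OF i] by (simp add: DERIV_deriv_iff_real_differentiable)
    then have "((\<lambda>\<alpha>. exp (ln (?w i \<alpha>))) has_real_derivative exp (ln (?w i a)) * ?l i) (at a)"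
      by (rule DERIV_fun_exp)
    moreover have "\<forall>\<^sub>F \<alpha> in nhds a. exp (ln (?w i \<alpha>)) = ?w i \<alpha>"
      using pos[OF i] by eventually_elim simp
    ultimately show ?thesis
      using pos_a[OF i] by (simp cong: DERIV_cong_ev)
  qed
  have "((\<lambda>\<alpha>. \<Prod>i = 1..n. ?w i \<alpha>) has_real_derivative
      (\<Prod>i = 1..n. ?w i a) * (\<Sum>i = 1..n. ?w i a * ?l i / ?w i a)) (at a)"
    using pos_a w by (intro has_field_derivative_prod') force+
  also have "(\<Sum>i = 1..n. ?w i a * ?l i / ?w i a) = distortion_score h a P n x \<theta>"
    unfolding distortion_score_def using pos_a by (intro sum.cong) force+
  finally show ?thesis
    \<comment> \<open>The densities do not depend on \<alpha> and come out as a constant factor, so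
      they may vanish.\<close>
    unfolding distorted_likelihood_def prod.distrib mult.assoc by (rule DERIV_cmult)
qed

section \<open>Measurability and sign of the distorted likelihood in the model\<close>

context bayes_model
begin

lemma space_prior: "space prior = \<Theta>"
  using sets_eq_imp_space_eq[OF prior_sets] by (simp add: space_restrict_space)

text \<open>The target is restricted to \<open>{0..1}\<close> so that the map composes with
  \<open>distortion_deriv h\<close>, whose measurability is established only there.\<close>

lemma mcdf_measurable:
  "(\<lambda>\<theta>. mcdf (P \<theta>) z) \<in> prior \<rightarrow>\<^sub>M restrict_space borel {0..1}"
proof (rule measurable_restrict_space2)
  show "(\<lambda>\<theta>. mcdf (P \<theta>) z) \<in> space prior \<rightarrow> {0..1}"
  proof
    fix \<theta> assume "\<theta> \<in> space prior"
    then have "prob_space (P \<theta>)"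
      using measurable_space[OF kernel] by (auto simp: space_prob_algebra)
    then show "mcdf (P \<theta>) z \<in> {0..1}"
      by (simp add: mcdf_def prob_space.prob_le_1)
  qed
  show "(\<lambda>\<theta>. mcdf (P \<theta>) z) \<in> borel_measurable prior"
    unfolding mcdf_def
    by (rule measurable_compose[OF kernel measurable_measure_prob_algebra]) (simp add: borel_closed closed_atMost)
qed

lemma mcdf_bounds: "\<theta> \<in> \<Theta> \<Longrightarrow> mcdf (P \<theta>) z \<in> {0..1}"
  using measurable_space[OF mcdf_measurable] by (simp add: space_prior space_restrict_space)

lemma distorted_likelihood_measurable:
  assumes "distortion_function h"
  shows "distorted_likelihood h P f n x \<in> borel_measurable prior"
  unfolding distorted_likelihood_def[abs_def]
  by (intro borel_measurable_prod borel_measurable_times likelihood_measurable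
      measurable_compose[OF mcdf_measurable distortion_deriv_measurable[OF assms]])

lemma distorted_likelihood_nonneg:
  assumes "distortion_function h" "\<theta> \<in> \<Theta>"
  shows "0 \<le> distorted_likelihood h P f n x \<theta>"
  unfolding distorted_likelihood_def using assms
  by (intro prod_nonneg ballI mult_nonneg_nonneg density_nonneg distortion_deriv_nonneg mcdf_bounds)

lemma distorted_likelihood_id:
  assumes "\<And>y. y \<in> {0..1} \<Longrightarrow> h y = y" "\<theta> \<in> \<Theta>"
  shows "distorted_likelihood h P f n x \<theta> = likelihood f n x \<theta>"
  using assms distortion_deriv_id[OF assms(1) mcdf_bounds]
  by (simp add: distorted_likelihood_def likelihood_def)

end

(* The covariance is taken under the completed posterior because the pointwise
   alpha-derivative is specified only up to a prior null set, hence measurable only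
   with respect to the completion; Borel functions have the same integrals under both.
   dominated_normaliser is dominated_g with g = 1: it lets the normalising constant
   be differentiated under the integral, and the claim fails without it (g may vanish). *)
theorem theorem1:
  fixes \<Theta> :: "(real ^ 'k) set"
    and prior :: "(real ^ 'k) measure"
    and P :: "real ^ 'k \<Rightarrow> (real ^ 'd) measure"
    and f :: "real ^ 'k \<Rightarrow> real ^ 'd \<Rightarrow> real"
    and n :: nat
    and x :: "nat \<Rightarrow> real ^ 'd"
    and h :: "real \<Rightarrow> real \<Rightarrow> real"
    and \<alpha>\<^sub>0 \<delta>\<^sub>0 \<delta>\<^sub>1 :: real
    and g :: "real ^ 'k \<Rightarrow> real ^ 's"
    and G G\<^sub>1 :: "real ^ 'k \<Rightarrow> real"
  assumes model: "bayes_model \<Theta> prior P f"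
    and bayes_rule: "integrable prior (likelihood f n x)" "0 < (\<integral>\<theta>. likelihood f n x \<theta> \<partial>prior)"
    and distortion: "\<And>\<alpha>. distortion_function (h \<alpha>)"
    and undistorted: "\<And>y. y \<in> {0..1} \<Longrightarrow> h \<alpha>\<^sub>0 y = y"
    and log_differentiable:
      "AE \<theta> in prior. \<forall>i \<in> {1..n}.
         (\<forall>\<^sub>F \<alpha> in nhds \<alpha>\<^sub>0. 0 < distortion_deriv (h \<alpha>) (mcdf (P \<theta>) (x i))) \<and>
         (\<lambda>\<alpha>. ln (distortion_deriv (h \<alpha>) (mcdf (P \<theta>) (x i)))) differentiable (at \<alpha>\<^sub>0)"
    and g_measurable: "g \<in> borel_measurable prior"
    and g_expectation: "integrable (posterior prior (likelihood f n x)) g"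
    and dominated_g: "0 < \<delta>\<^sub>0"
      "dominated_quotients prior (\<lambda>\<alpha>. distorted_likelihood (h \<alpha>) P f n x) \<alpha>\<^sub>0 \<delta>\<^sub>0 g G"
    and dominated_normaliser: "0 < \<delta>\<^sub>1"
      "dominated_quotients prior (\<lambda>\<alpha>. distorted_likelihood (h \<alpha>) P f n x) \<alpha>\<^sub>0 \<delta>\<^sub>1 (\<lambda>_. 1 :: real) G\<^sub>1"
  shows "covariance_exists (completion (posterior prior (likelihood f n x))) g (distortion_score h \<alpha>\<^sub>0 P n x) \<and>
    ((\<lambda>\<alpha>. \<integral>\<theta>. g \<theta> \<partial>(posterior prior (distorted_likelihood (h \<alpha>) P f n x)))
       has_vector_derivative
         covariance_vec (completion (posterior prior (likelihood f n x))) g (distortion_score h \<alpha>\<^sub>0 P n x))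
      (at \<alpha>\<^sub>0)"
proof -
  interpret bayes_model \<Theta> prior P f
    by (rule model)
  let ?L = "\<lambda>\<alpha>. distorted_likelihood (h \<alpha>) P f n x"
  \<comment> \<open>Off \<Theta> the value of \<open>mcdf\<close> need not lie in
    \<open>{0..1}\<close>, so the two functions are compared on the space of the prior only, which
    is enough for integrals and densities.\<close>
  have eq: "?L \<alpha>\<^sub>0 \<theta> = likelihood f n x \<theta>" if "\<theta> \<in> space prior" for \<theta>
    using that distorted_likelihood_id[OF undistorted] by (simp add: space_prior)
  have int: "integrable prior (?L \<alpha>\<^sub>0)" "0 < (\<integral>\<theta>. ?L \<alpha>\<^sub>0 \<theta> \<partial>prior)"
    using bayes_rule eq by (simp_all cong: Bochner_Integration.integrable_cong Bochner_Integration.integral_cong)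
  have post: "posterior prior (likelihood f n x) = posterior prior (?L \<alpha>\<^sub>0)"
    unfolding posterior_def using eq bayes_rule(1) int(1)
    by (intro density_cong) (auto cong: Bochner_Integration.integral_cong)
  have deriv: "AE \<theta> in prior. ((\<lambda>\<alpha>. ?L \<alpha> \<theta>) has_real_derivative
      ?L \<alpha>\<^sub>0 \<theta> * distortion_score h \<alpha>\<^sub>0 P n x \<theta>) (at \<alpha>\<^sub>0)"
    using log_differentiable
    by eventually_elim (rule has_real_derivative_distorted_likelihood; blast)
  have meas: "\<And>\<alpha>. ?L \<alpha> \<in> borel_measurable prior"
    and nonneg: "\<And>\<alpha> \<theta>. \<theta> \<in> space prior \<Longrightarrow> 0 \<le> ?L \<alpha> \<theta>"
    using distorted_likelihood_measurable[OF distortion] distorted_likelihood_nonneg[OF distortion]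
    by (auto simp: space_prior)
  note sensitivity = has_vector_derivative_posterior_expectation[of ?L prior \<alpha>\<^sub>0 g,
      OF meas nonneg int g_measurable g_expectation[unfolded post] deriv dominated_g dominated_normaliser]
  show ?thesis
    unfolding post using sensitivity by blast
qed

end
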